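(* Let $n\ge 2$, let $A=(n,f)$ be an NCCA with value-1 pattern set $P_A\subseteq\{0,1\}^n$, and let $\hat P_A\subseteq\{0,1\}^{n-1}$ be a bundle pattern set of $P_A$ with $|\hat P_A|=|P_A|/2$. Let $B=(n-1,g)$ be the CA of neighborhood size $n-1$ whose value-1 pattern set is $P_B=\hat P_A$, i.e. $g(r)=1$ if and only if $r\in\hat P_A$. Then $B$ is an NCCA.
   Context: A (1-dimensional, 2-state) cellular automaton (CA) of neighborhood size $n\ge 1$ (an $n$-cell CA) is a pair $A=(n,f)$ with local function $f:\{0,1\}^n\to\{0,1\}$. Its global function $F$ acts on configurations $c:\mathbb{Z}\to\{0,1\}$ by $F(c)(i)=f(c(i)c(i+1)\cdots c(i+n-1))$. $A$ is number-conserving (an NCCA) if for every finite configuration $c$ (finitely many cells in state $1$), $F(c)$ is also finite and $\sum_{i\in\mathbb{Z}}(F(c)(i)-c(i))=0$, i.e. $c$ and $F(c)$ have the same number of 1s. The value-1 pattern set of $A=(n,f)$ is $P_A=\{p\in\{0,1\}^n : f(p)=1\}$. Write $\bar a=1-a$. Let $P\subseteq\{0,1\}^n$ with $n\ge 2$. Two patterns $p,q\in P$ can be paired if they differ exactly in the first letter, i.e. $\{p,q\}=\{0r,1r\}$, or exactly in the last letter, i.e. $\{p,q\}=\{r0,r1\}$, for some $r\in\{0,1\}^{n-1}$; this (unique) $r$ is called the bundle pattern of the pair. A bundle pattern set of $P$ is a set $\hat P\subseteq\{0,1\}^{n-1}$ for which there is a partition of $P$ into two-element sets $\{p,q\}$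 that can be paired (so each pattern of $P$ is used in exactly one pair) such that $\hat P$ is the set of the bundle patterns of these pairs. (The condition $|\hat P|=|P|/2$ says that distinct pairs have distinct bundle patterns.) *)

theory Defs
  imports Main "HOL-Library.Disjoint_Sets" "HOL-Library.Groups_Big_Fun"
begin

(* States 0 and 1 are False and True; the words of length n are the lists in "patterns n". *)

type_synonym config = "int \<Rightarrow> bool"

definition patterns :: "nat \<Rightarrow> bool list set" where
  "patterns n = {p. length p = n}"

(* A cellular automaton (n, f). Only the values of f on "patterns n" matter:
   every notion below inspects f on that set only. *)
type_synonym ca = "nat \<times> (bool list \<Rightarrow> bool)"

definition global_fun :: "ca \<Rightarrow> config \<Rightarrow> config" where
  "global_fun A c = (\<lambda>i. snd A (map (\<lambda>k. c (i + int k)) [0..<fst A]))"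

definition finite_config :: "config \<Rightarrow> bool" where
  "finite_config c \<longleftrightarrow> finite {i. c i}"

(* The sum over all integers is the finite-support sum Sum_any, which is 0 by convention when
   the support is infinite; the first conjunct of the conclusion rules that out. *)
definition is_ncca :: "ca \<Rightarrow> bool" where
  "is_ncca A \<longleftrightarrow> fst A \<ge> 1 \<and>
     (\<forall>c. finite_config c \<longrightarrow>
        finite_config (global_fun A c) \<and>
        (\<Sum>i. of_bool (global_fun A c i) - of_bool (c i) :: int) = 0)"

definition value1_patterns :: "ca \<Rightarrow> bool list set" where
  "value1_patterns A = {p \<in> patterns (fst A). snd A p}"

(* S is a pair that differs exactly in the first, or exactly in the last, letter,
   and r is the common remainder. Such an S has exactly two elements. *)
definition is_bundle_pattern :: "bool list \<Rightarrow> bool list set \<Rightarrow> bool" where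
  "is_bundle_pattern r S \<longleftrightarrow>
     S = {False # r, True # r} \<or> S = {r @ [False], r @ [True]}"

(* For n >= 2 a pair S has at most one bundle pattern, so the set comprehension
   picks exactly one r for each block S of the partition. *)
definition is_bundle_pattern_set :: "nat \<Rightarrow> bool list set \<Rightarrow> bool list set \<Rightarrow> bool" where
  "is_bundle_pattern_set n P Q \<longleftrightarrow>
     (\<exists>Prs. partition_on P Prs \<and>
          (\<forall>S\<in>Prs. \<exists>r\<in>patterns (n - 1). is_bundle_pattern r S) \<and>
          Q = {r \<in> patterns (n - 1). \<exists>S\<in>Prs. is_bundle_pattern r S})"

end

theory Submission
  imports Defs
begin

text \<open>
  A pattern is paired through its first or through its last letter, so \<open>f\<close> is the disjoint
  sum of the indicator of \<open>A\<close> on the word without its first letter and the indicator of \<open>B\<close> on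
  the word without its last letter, where \<open>A\<close> and \<open>B\<close> collect the bundle patterns of the two
  kinds. The cardinality hypothesis forces \<open>A\<close> and \<open>B\<close> to be disjoint, so \<open>g\<close> is the disjoint sum
  of the two indicators on the same word. Hence the images of a configuration under the two
  automata only differ by a shift of the cells contributed by \<open>A\<close>, and they contain the same
  number of ones.
\<close>

lemma Sum_any_of_bool_diff:
  assumes "finite {i. P i}" "finite {i. Q i}"
  shows "(\<Sum>i. of_bool (P i) - of_bool (Q i) :: int) = int (card {i. P i}) - int (card {i. Q i})"
proof -
  \<comment> \<open>The support can be smaller than \<open>?U\<close>, since the summand vanishes
    wherever \<open>P\<close> and \<open>Q\<close> both hold; any finite superset of the support
    serves.\<close>
  let ?U = "{i. P i} \<union> {i. Q i}"
  have "(\<Sum>i. of_bool (P i) - of_bool (Q i) :: int) = (\<Sum>i\<in>?U. of_bool (P i) - of_bool (Q i))"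
    using assms by (intro Sum_any.expand_superset) (use of_bool_eq_0_iff in fastforce)+
  also have "\<dots> = (\<Sum>i\<in>?U. of_bool (P i)) - (\<Sum>i\<in>?U. of_bool (Q i))"
    by (rule sum_subtractf)
  also have "(\<Sum>i\<in>?U. of_bool (P i) :: int) = int (card (?U \<inter> {i. P i}))"
    using assms by (subst sum_of_bool_eq) simp_all
  also have "(\<Sum>i\<in>?U. of_bool (Q i) :: int) = int (card (?U \<inter> {i. Q i}))"
    using assms by (subst sum_of_bool_eq) simp_all
  also have "?U \<inter> {i. P i} = {i. P i}" by blast
  also have "?U \<inter> {i. Q i} = {i. Q i}" by blast
  finally show ?thesis .
qed

lemma is_ncca_iff_card:
  "is_ncca A \<longleftrightarrow> fst A \<ge> 1 \<and>
     (\<forall>c. finite {i. c i} \<longrightarrow>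
        finite {i. global_fun A c i} \<and> card {i. global_fun A c i} = card {i. c i})"
proof -
  have "finite_config (global_fun A c) \<and>
      (\<Sum>i. of_bool (global_fun A c i) - of_bool (c i) :: int) = 0 \<longleftrightarrow>
    finite {i. global_fun A c i} \<and> card {i. global_fun A c i} = card {i. c i}"
    if "finite {i. c i}" for c
    unfolding finite_config_def
    using Sum_any_of_bool_diff[OF _ that, of "global_fun A c"] by auto
  then show ?thesis
    unfolding is_ncca_def finite_config_def by blast
qed

text \<open>If \<open>s\<close> is nonempty, the words on the right share their first letter, unlike
  those on the left; if \<open>s\<close> is empty, the lengths differ. For \<open>r = s = []\<close>
  both sides are the set of all one-letter words.\<close>

lemma first_last_pair_neq:
  assumes "r \<noteq> [] \<or> s \<noteq> []"
  shows "{False # r, True # r} \<noteq> {s @ [False], s @ [True]}"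
  using assms by (cases s) (auto simp: doubleton_eq_iff)

lemma bundle_pattern_unique:
  assumes "is_bundle_pattern r S" "is_bundle_pattern s S" "r \<noteq> []" "s \<noteq> []"
  shows "r = s"
  using assms(1)[unfolded is_bundle_pattern_def]
proof
  assume "S = {False # r, True # r}"
  then have "{False # r, True # r} = {False # s, True # s}"
    using assms first_last_pair_neq[of r s] by (metis is_bundle_pattern_def)
  then show ?thesis
    by (simp add: doubleton_eq_iff)
next
  assume "S = {r @ [False], r @ [True]}"
  then have "{r @ [False], r @ [True]} = {s @ [False], s @ [True]}"
    using assms first_last_pair_neq[of s r] by (metis is_bundle_pattern_def)
  then show ?thesis
    by (simp add: doubleton_eq_iff)
qed

lemma card_bundle_pair: "is_bundle_pattern r S \<Longrightarrow> card S = 2"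
  by (auto simp: is_bundle_pattern_def)

lemma finite_patterns: "finite (patterns n)"
  using finite_lists_length_eq[of "UNIV :: bool set" n] by (simp add: patterns_def)

lemma bundle_decomposition:
  assumes n: "n \<ge> 2"
    and P: "P \<subseteq> patterns n"
    and bps: "is_bundle_pattern_set n P Q"
    and card: "2 * card Q = card P"
  obtains A B where "Q = A \<union> B" "A \<inter> B = {}"
    "\<And>p. p \<in> patterns n \<Longrightarrow> p \<in> P \<longleftrightarrow> tl p \<in> A \<or> butlast p \<in> B"
    "\<And>p. p \<in> patterns n \<Longrightarrow> \<not> (tl p \<in> A \<and> butlast p \<in> B)"
proof -
  obtain Prs where part: "partition_on P Prs"
    and ex: "\<And>S. S \<in> Prs \<Longrightarrow> \<exists>r\<in>patterns (n - 1). is_bundle_pattern r S"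
    and Q: "Q = {r \<in> patterns (n - 1). \<exists>S\<in>Prs. is_bundle_pattern r S}"
    using bps unfolding is_bundle_pattern_set_def by blast
  have ne: "r \<noteq> []" if "r \<in> patterns (n - 1)" for r
    using that n by (auto simp: patterns_def)
  obtain b where b: "\<And>S. S \<in> Prs \<Longrightarrow> b S \<in> patterns (n - 1) \<and> is_bundle_pattern (b S) S"
    using ex by metis
  have bI: "b S = r" if "S \<in> Prs" "r \<in> patterns (n - 1)" "is_bundle_pattern r S" for S r
    using that b ne bundle_pattern_unique by metis
  have "Q = b ` Prs"
    unfolding Q using b bI by (auto simp: image_iff)
  moreover have finP: "finite P"
    using P finite_patterns finite_subset by blast
  moreover have finPrs: "finite Prs"
    using finite_elements[OF finP part] .
  moreover have "card P = 2 * card Prs"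
  proof -
    have "card (\<Union>Prs) = sum card Prs"
      using part finP
      by (intro card_Union_disjoint)
        (auto simp: partition_on_def disjoint_def pairwise_def disjnt_def intro: finite_subset)
    also have "\<dots> = (\<Sum>S\<in>Prs. 2)"
      by (rule sum.cong[OF refl]) (use b card_bundle_pair in blast)
    also have "\<dots> = 2 * card Prs"
      by simp
    finally show ?thesis
      using part by (simp add: partition_on_def)
  qed
  \<comment> \<open>All blocks have two elements, so the cardinality hypothesis says that
    \<open>Q\<close>, the image of \<open>Prs\<close> under \<open>b\<close>, has as many elements
    as \<open>Prs\<close>.\<close>
  ultimately have inj: "inj_on b Prs"
    using card by (simp add: inj_on_iff_eq_card)
  define A where "A = {r \<in> patterns (n - 1). {False # r, True # r} \<in> Prs}"
  define B where "B = {r \<in> patterns (n - 1). {r @ [False], r @ [True]} \<in> Prs}"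
  have QAB: "Q = A \<union> B"
    unfolding Q A_def B_def is_bundle_pattern_def by auto
  have "A \<inter> B = {}"
  proof (rule ccontr)
    assume "A \<inter> B \<noteq> {}"
    then obtain r where r: "r \<in> patterns (n - 1)"
      and S: "{False # r, True # r} \<in> Prs" "{r @ [False], r @ [True]} \<in> Prs"
      unfolding A_def B_def by blast
    \<comment> \<open>A common element \<open>r\<close> would be the bundle pattern of two blocks,
      which are distinct because \<open>r\<close> is nonempty; this contradicts injectivity of
      \<open>b\<close>.\<close>
    have "b {False # r, True # r} = r" "b {r @ [False], r @ [True]} = r"
      using bI S r by (simp_all add: is_bundle_pattern_def)
    then show False
      using inj S first_last_pair_neq[of r r] ne[OF r] by (metis inj_onD)
  qed
  moreover have "p \<in> P \<longleftrightarrow> tl p \<in> A \<or> butlast p \<in> B" if p: "p \<in> patterns n" for p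
  proof -
    have "p \<noteq> []" "length p = n" using p n by (auto simp: patterns_def)
    \<comment> \<open>The only first-letter pair containing \<open>p\<close> is fixed by
      \<open>tl p\<close>, the only last-letter pair by \<open>butlast p\<close>. Whether a block
      covers \<open>p\<close> can thus be read off from these two words.\<close>
    have hd: "p \<in> {False # tl p, True # tl p}"
      using \<open>p \<noteq> []\<close> by (cases p) auto
    have last: "p \<in> {butlast p @ [False], butlast p @ [True]}"
      using \<open>p \<noteq> []\<close> by (cases p rule: rev_cases) auto
    have PU: "P = \<Union>Prs" using part by (simp add: partition_on_def)
    show ?thesis
    proof
      assume "p \<in> P"
      then obtain S where S: "S \<in> Prs" "p \<in> S" using PU by blast
      then obtain r where "r \<in> patterns (n - 1)" "is_bundle_pattern r S" using ex by blast
      then show "tl p \<in> A \<or> butlast p \<in> B"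
        using S unfolding is_bundle_pattern_def A_def B_def by auto
    next
      assume "tl p \<in> A \<or> butlast p \<in> B"
      then show "p \<in> P"
        using hd last unfolding PU A_def B_def by blast
    qed
  qed
  moreover have "\<not> (tl p \<in> A \<and> butlast p \<in> B)" if p: "p \<in> patterns n" for p
  proof
    assume "tl p \<in> A \<and> butlast p \<in> B"
    then have S: "{False # tl p, True # tl p} \<in> Prs"
        "{butlast p @ [False], butlast p @ [True]} \<in> Prs" and "tl p \<noteq> []"
      using ne by (auto simp: A_def B_def)
    have "p \<noteq> []" using \<open>tl p \<noteq> []\<close> by auto
    then have "p \<in> {False # tl p, True # tl p}" "p \<in> {butlast p @ [False], butlast p @ [True]}"
      by (cases p, auto) (cases p rule: rev_cases, auto)
    \<comment> \<open>Blocks of a partition that share the word \<open>p\<close> coincide, but a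
      first-letter pair is never a last-letter pair here.\<close>
    then have "{False # tl p, True # tl p} = {butlast p @ [False], butlast p @ [True]}"
      using disjointD[OF partition_onD2[OF part] S] by (meson disjoint_iff)
    then show False
      using first_last_pair_neq[OF disjI1[OF \<open>tl p \<noteq> []\<close>]] by simp
  qed
  ultimately show ?thesis
    using that QAB by blast
qed

text \<open>The size is a parameter so that both automata can be compared: dropping the last letter
  of a window keeps its position, dropping the first moves it one cell to the right.\<close>

definition window :: "config \<Rightarrow> nat \<Rightarrow> int \<Rightarrow> bool list" where
  "window c m i = map (\<lambda>k. c (i + int k)) [0..<m]"

lemma window_in_patterns: "window c m i \<in> patterns m"
  by (simp add: window_def patterns_def)

lemma butlast_window: "butlast (window c (Suc m) i) = window c m i"
  by (simp add: window_def)

lemma tl_window: "tl (window c (Suc m) i) = window c m (i + 1)"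
  by (rule nth_equalityI) (simp_all add: window_def nth_tl add.assoc del: upt_Suc)

lemma global_fun_window: "global_fun (m, h) c i = h (window c m i)"
  by (simp add: global_fun_def window_def)

theorem theorem1:
  fixes n :: nat and f g :: "bool list \<Rightarrow> bool" and Q :: "bool list set"
  assumes "n \<ge> 2"
    and "is_ncca (n, f)"
    and "is_bundle_pattern_set n (value1_patterns (n, f)) Q"
    and "2 * card Q = card (value1_patterns (n, f))"
    and "value1_patterns (n - 1, g) = Q"
  shows "is_ncca (n - 1, g)"
proof -
  define m where "m = n - 1"
  have n: "n = Suc m" and "m \<ge> 1" using assms(1) by (auto simp: m_def)
  have "value1_patterns (n, f) \<subseteq> patterns n"
    by (auto simp: value1_patterns_def)
  then obtain A B where AB: "Q = A \<union> B" "A \<inter> B = {}"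
    and f1: "\<And>p. p \<in> patterns n \<Longrightarrow> p \<in> value1_patterns (n, f) \<longleftrightarrow> tl p \<in> A \<or> butlast p \<in> B"
    and f2: "\<And>p. p \<in> patterns n \<Longrightarrow> \<not> (tl p \<in> A \<and> butlast p \<in> B)"
    using bundle_decomposition[OF assms(1) _ assms(3,4)] by metis
  have "finite {i. global_fun (m, g) c i} \<and> card {i. global_fun (m, g) c i} = card {i. c i}"
    if c: "finite {i. c i}" for c
  proof -
    let ?X = "{i. window c m i \<in> A}" and ?Y = "{i. window c m i \<in> B}"
    let ?X' = "{i. window c m (i + 1) \<in> A}"
    have "global_fun (n, f) c i \<longleftrightarrow> window c m (i + 1) \<in> A \<or> window c m i \<in> B" for i
      using f1[OF window_in_patterns, of c i] window_in_patterns[of c n i]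
      by (simp add: global_fun_window value1_patterns_def n tl_window butlast_window)
    then have F: "{i. global_fun (n, f) c i} = ?X' \<union> ?Y" by blast
    have disjF: "?X' \<inter> ?Y = {}"
      using f2[OF window_in_patterns, of c] by (auto simp: n tl_window butlast_window)
    have "global_fun (m, g) c i \<longleftrightarrow> window c m i \<in> A \<or> window c m i \<in> B" for i
      using assms(5) AB(1) window_in_patterns[of c m i]
      by (auto simp: global_fun_window value1_patterns_def m_def)
    then have G: "{i. global_fun (m, g) c i} = ?X \<union> ?Y" by blast
    have disjG: "?X \<inter> ?Y = {}" using AB(2) by blast
    have shift: "bij_betw (\<lambda>i. i + 1) ?X' ?X"
      by (rule bij_betw_byWitness[where f' = "\<lambda>i. i - 1"]) auto
    \<comment> \<open>Conservation by \<open>f\<close> enters here. It bounds only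
      \<open>?X'\<close> and \<open>?Y\<close>; finiteness of \<open>?X\<close>, required for
      \<open>g\<close>, is then carried over by the shift.\<close>
    have NF: "finite (?X' \<union> ?Y)" "card (?X' \<union> ?Y) = card {i. c i}"
      using assms(2) c unfolding F[symmetric] is_ncca_iff_card by auto
    then have "finite ?X" using bij_betw_finite[OF shift] by simp
    then have "card (?X \<union> ?Y) = card (?X' \<union> ?Y)"
      using NF(1) disjF disjG bij_betw_same_card[OF shift] by (simp add: card_Un_disjoint)
    then show ?thesis
      using NF \<open>finite ?X\<close> unfolding G by simp
  qed
  then show ?thesis
    using \<open>m \<ge> 1\<close> unfolding is_ncca_iff_card m_def by simp
qed

end
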